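(* Let $\mathcal B$ be a building of type $(W,I)$ with $W$ infinite, with chamber set $C$, and let $G$ be a topological group that acts properly on the discrete space $C$ as a group of automorphisms of $\mathcal B$. Then the following are equivalent. (i) The action is infinitely Weyl-transitive. (ii) The action is Weyl-transitive.
   Context: All topological spaces and groups are Hausdorff. A continuous map is proper if it is closed and preimages of points are compact. A continuous action $G\times X\to X$ of a topological group on a space is proper if the map $G\times X\to X\times X$, $(g,x)\mapsto(gx,x)$ is proper. Coxeter systems. Let $I$ be a finite set and $(m_{i,j})_{i,j\in I}$ a symmetric matrix with entries in $\{1,2,3,\ldots,\infty\}$, $m_{i,i}=1$ and $m_{i,j}\ge 2$ for $i\ne j$. The associated Coxeter system $(W,I)$ consists of the group $W=\langle I\mid (ij)^{m_{i,j}}=1 \text{ if } m_{i,j}\neq\infty\rangle$ and its generating set $I$; $\ell$ is the word length, and $w=i_1\cdots i_m$ is reduced if $\ell(w)=m$. Buildings. A building $\mathcal B=(C,EC,t,\delta)$ of type $(W,I)$ consists of a simplicial graph $(C,EC)$ with vertex set $C$ (the chambers) and edge set $EC$, an edge coloring $t:EC\to I$, and a map $\delta:C\times C\to W$. Chambers joined by an edge of color $i$ are called $i$-adjacent. A gallery of type $(i_1,\ldots,i_m)$ is a sequence $(c_0,\ldots,c_m)$ of chambers with $c_{s-1}$ $i_s$-adjacent to $c_s$. Axioms: (B1) for every chamber $a$ and $i\in I$ there is at least one chamber $b$ which is $i$-adjacent to $a$, and if another chamber $c$ is $i$-adjacent to $a$, then $b$ and $c$ are $i$-adjacent; (B2)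 if $w=i_1\cdots i_m$ is reduced, then $\delta(a,b)=w$ if and only if there is a gallery of type $(i_1,\ldots,i_m)$ from $a$ to $b$. An automorphism of $\mathcal B$ is a graph automorphism preserving the edge coloring. Transitivity. An action of a group $G$ on $\mathcal B$ by automorphisms is Weyl-transitive if for all chambers $a,b,a',b'$ with $\delta(a,b)=\delta(a',b')$ there is $g\in G$ with $ga=a'$ and $gb=b'$. A string $(i_s)_{s\in\mathbb Z}\in I^{\mathbb Z}$ is reduced if $\ell(i_si_{s+1}\cdots i_{s+r})=r+1$ for all $s\in\mathbb Z$ and $r\ge 0$. An infinite gallery of type $(i_s)_{s\in\mathbb Z}$ is a sequence of chambers $(c_s)_{s\in\mathbb Z}$ where $c_{s-1}$ is $i_s$-adjacent to $c_s$ for all $s\in\mathbb Z$. The action is infinitely Weyl-transitive if for every infinite reduced string $(i_s)_{s\in\mathbb Z}$ and every pair of infinite galleries $(c_s)_{s\in\mathbb Z}$, $(c'_s)_{s\in\mathbb Z}$ of type $(i_s)_{s\in\mathbb Z}$ there is $g\in G$ with $gc_s=c'_s$ for all $s\in\mathbb Z$. *)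

theory Defs
  imports "HOL-Analysis.Analysis" "HOL-Algebra.Group_Action" "HOL-Library.Extended_Nat"
begin

text \<open>Groups given by generators and relations. A letter \<open>(s, True)\<close> stands for the
  generator \<open>s\<close>, and \<open>(s, False)\<close> for its formal inverse.\<close>

type_synonym 's word = "('s \<times> bool) list"

abbreviation words :: "'s set \<Rightarrow> 's word set" where
  "words S \<equiv> lists (S \<times> UNIV)"

inductive_set presentation_rel :: "'s set \<Rightarrow> 's word set \<Rightarrow> ('s word \<times> 's word) set"
  for S :: "'s set" and R :: "'s word set" where
  refl: "u \<in> words S \<Longrightarrow> (u, u) \<in> presentation_rel S R"
| sym: "(u, v) \<in> presentation_rel S R \<Longrightarrow> (v, u) \<in> presentation_rel S R"
| trans: "(u, v) \<in> presentation_rel S R \<Longrightarrow> (v, w) \<in> presentation_rel S R \<Longrightarrow>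
    (u, w) \<in> presentation_rel S R"
| cancel: "u \<in> words S \<Longrightarrow> v \<in> words S \<Longrightarrow> s \<in> S \<Longrightarrow>
    (u @ [(s, b), (s, \<not> b)] @ v, u @ v) \<in> presentation_rel S R"
| relator: "u \<in> words S \<Longrightarrow> v \<in> words S \<Longrightarrow> r \<in> R \<Longrightarrow> r \<in> words S \<Longrightarrow>
    (u @ r @ v, u @ v) \<in> presentation_rel S R"

definition presented_group :: "'s set \<Rightarrow> 's word set \<Rightarrow> 's word set monoid" where
  "presented_group S R =
    \<lparr>carrier = words S // presentation_rel S R,
     mult = (\<lambda>A B. \<Union>u\<in>A. \<Union>v\<in>B. presentation_rel S R `` {u @ v}),
     one = presentation_rel S R `` {[]}\<rparr>"

lemma presentation_rel_words:
  "(u, v) \<in> presentation_rel S R \<Longrightarrow> u \<in> words S \<and> v \<in> words S"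
  by (induction rule: presentation_rel.induct) auto

lemma equiv_presentation_rel: "equiv (words S) (presentation_rel S R)"
proof (rule equivI)
  show "presentation_rel S R \<subseteq> words S \<times> words S"
    using presentation_rel_words by fast
  show "refl_on (words S) (presentation_rel S R)"
    by (rule refl_onI) (rule presentation_rel.refl)
  show "sym (presentation_rel S R)"
    by (rule symI) (rule presentation_rel.sym)
  show "trans (presentation_rel S R)"
    by (rule transI) (rule presentation_rel.trans)
qed

lemma presentation_rel_append:
  assumes "(u, v) \<in> presentation_rel S R" "a \<in> words S" "b \<in> words S"
  shows "(a @ u @ b, a @ v @ b) \<in> presentation_rel S R"
  using assms
proof (induction rule: presentation_rel.induct)
  case (refl u)
  then show ?case by (intro presentation_rel.refl) simp
next
  case (sym u v)
  then show ?case by (blast intro: presentation_rel.sym)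
next
  case (trans u v w)
  then show ?case by (blast intro: presentation_rel.trans)
next
  case (cancel u v s c)
  then show ?case
    using presentation_rel.cancel[of "a @ u" S "v @ b" s c R] by simp
next
  case (relator u v r)
  then show ?case
    using presentation_rel.relator[of "a @ u" S "v @ b" r R] by simp
qed

lemma presented_group_mult:
  assumes "u \<in> words S" "v \<in> words S"
  shows "presentation_rel S R `` {u} \<otimes>\<^bsub>presented_group S R\<^esub> presentation_rel S R `` {v} =
    presentation_rel S R `` {u @ v}"
proof -
  have "congruent2 (presentation_rel S R) (presentation_rel S R)
      (\<lambda>u v. presentation_rel S R `` {u @ v})"
  proof (rule congruent2I')
    fix u u' v v'
    assume uu': "(u, u') \<in> presentation_rel S R" and vv': "(v, v') \<in> presentation_rel S R"
    have w: "u \<in> words S" "u' \<in> words S" "v \<in> words S" "v' \<in> words S"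
      using presentation_rel_words uu' vv' by fast+
    have "(u @ v, u' @ v) \<in> presentation_rel S R"
      using presentation_rel_append[OF uu', of "[]" v] w by simp
    moreover have "(u' @ v, u' @ v') \<in> presentation_rel S R"
      using presentation_rel_append[OF vv', of u' "[]"] w by simp
    ultimately have "(u @ v, u' @ v') \<in> presentation_rel S R"
      by (rule presentation_rel.trans)
    then show "presentation_rel S R `` {u @ v} = presentation_rel S R `` {u' @ v'}"
      by (rule equiv_class_eq[OF equiv_presentation_rel])
  qed
  from UN_equiv_class2[OF equiv_presentation_rel equiv_presentation_rel this assms]
  show ?thesis by (simp add: presented_group_def)
qed

lemma inverse_word:
  "u \<in> words S \<Longrightarrow> \<exists>v\<in>words S. (v @ u, []) \<in> presentation_rel S R"
proof (induction u)
  case Nil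
  then show ?case using presentation_rel.refl[of "[]" S R] by force
next
  case (Cons x u)
  obtain s b where x: "x = (s, b)" by fastforce
  from Cons obtain v where v: "v \<in> words S" "(v @ u, []) \<in> presentation_rel S R" by auto
  have "((v @ [(s, \<not> b)]) @ x # u, v @ u) \<in> presentation_rel S R"
    using presentation_rel.cancel[of v S u s "\<not> b" R] v Cons.prems x by simp
  then have "((v @ [(s, \<not> b)]) @ x # u, []) \<in> presentation_rel S R"
    using v(2) by (rule presentation_rel.trans)
  moreover have "v @ [(s, \<not> b)] \<in> words S" using v Cons.prems x by simp
  ultimately show ?case by blast
qed

lemma group_presented_group: "group (presented_group S R)"
proof (rule groupI)
  have car: "carrier (presented_group S R) = (\<lambda>u. presentation_rel S R `` {u}) ` words S"
    by (auto simp: presented_group_def quotient_def)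
  have one: "\<one>\<^bsub>presented_group S R\<^esub> = presentation_rel S R `` {[]}"
    by (simp add: presented_group_def)
  show "\<one>\<^bsub>presented_group S R\<^esub> \<in> carrier (presented_group S R)"
    unfolding car one by (rule imageI) simp
  fix x assume "x \<in> carrier (presented_group S R)"
  then obtain u where u: "u \<in> words S" "x = presentation_rel S R `` {u}"
    unfolding car by blast
  show "\<one>\<^bsub>presented_group S R\<^esub> \<otimes>\<^bsub>presented_group S R\<^esub> x = x"
    using presented_group_mult[of "[]" S u R] u by (simp add: one)
  obtain v where v: "v \<in> words S" "(v @ u, []) \<in> presentation_rel S R"
    using inverse_word u by blast
  have "presentation_rel S R `` {v} \<otimes>\<^bsub>presented_group S R\<^esub> x = \<one>\<^bsub>presented_group S R\<^esub>"
    using equiv_class_eq[OF equiv_presentation_rel v(2)] v(1) u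
    by (simp add: presented_group_mult one)
  then show "\<exists>y\<in>carrier (presented_group S R).
      y \<otimes>\<^bsub>presented_group S R\<^esub> x = \<one>\<^bsub>presented_group S R\<^esub>"
    using v(1) unfolding car by blast
  fix y assume "y \<in> carrier (presented_group S R)"
  then obtain v where v: "v \<in> words S" "y = presentation_rel S R `` {v}"
    unfolding car by blast
  have "u @ v \<in> words S" using u v by simp
  then show "x \<otimes>\<^bsub>presented_group S R\<^esub> y \<in> carrier (presented_group S R)"
    using u v unfolding car by (simp only: presented_group_mult) blast
  fix z assume "z \<in> carrier (presented_group S R)"
  then obtain w where w: "w \<in> words S" "z = presentation_rel S R `` {w}"
    unfolding car by blast
  have "v @ w \<in> words S" using v w by simp
  then show "x \<otimes>\<^bsub>presented_group S R\<^esub> y \<otimes>\<^bsub>presented_group S R\<^esub> z =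
      x \<otimes>\<^bsub>presented_group S R\<^esub> (y \<otimes>\<^bsub>presented_group S R\<^esub> z)"
    using \<open>u @ v \<in> words S\<close> u v w by (simp only: presented_group_mult append_assoc)
qed

locale coxeter_matrix =
  fixes I :: "'i set" and m :: "'i \<Rightarrow> 'i \<Rightarrow> enat"
  assumes finite: "finite I"
    and symmetric: "\<And>i j. i \<in> I \<Longrightarrow> j \<in> I \<Longrightarrow> m i j = m j i"
    and diagonal: "\<And>i. i \<in> I \<Longrightarrow> m i i = 1"
    and off_diagonal: "\<And>i j. i \<in> I \<Longrightarrow> j \<in> I \<Longrightarrow> i \<noteq> j \<Longrightarrow> m i j \<ge> 2"

definition coxeter_relators :: "'i set \<Rightarrow> ('i \<Rightarrow> 'i \<Rightarrow> enat) \<Rightarrow> 'i word set" where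
  "coxeter_relators I m =
    {concat (replicate n [(i, True), (j, True)]) | i j n. i \<in> I \<and> j \<in> I \<and> m i j = enat n}"

definition coxeter_group :: "'i set \<Rightarrow> ('i \<Rightarrow> 'i \<Rightarrow> enat) \<Rightarrow> 'i word set monoid" where
  "coxeter_group I m = presented_group I (coxeter_relators I m)"

definition coxeter_generator :: "'i set \<Rightarrow> ('i \<Rightarrow> 'i \<Rightarrow> enat) \<Rightarrow> 'i \<Rightarrow> 'i word set" where
  "coxeter_generator I m i = presentation_rel I (coxeter_relators I m) `` {[(i, True)]}"

text \<open>The element \<open>i\<^sub>1 \<cdots> i\<^sub>k\<close> of the Coxeter group.\<close>

definition coxeter_prod :: "'i set \<Rightarrow> ('i \<Rightarrow> 'i \<Rightarrow> enat) \<Rightarrow> 'i list \<Rightarrow> 'i word set" where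
  "coxeter_prod I m is =
    foldr (\<lambda>i w. coxeter_generator I m i \<otimes>\<^bsub>coxeter_group I m\<^esub> w) is \<one>\<^bsub>coxeter_group I m\<^esub>"

text \<open>Only positive words are needed for the word length, because the generators are
  involutions (\<open>m i i = 1\<close>).\<close>

definition coxeter_length :: "'i set \<Rightarrow> ('i \<Rightarrow> 'i \<Rightarrow> enat) \<Rightarrow> 'i word set \<Rightarrow> nat" where
  "coxeter_length I m w = (LEAST n. \<exists>is\<in>lists I. length is = n \<and> coxeter_prod I m is = w)"

definition reduced_word :: "'i set \<Rightarrow> ('i \<Rightarrow> 'i \<Rightarrow> enat) \<Rightarrow> 'i list \<Rightarrow> bool" where
  "reduced_word I m is \<longleftrightarrow>
    is \<in> lists I \<and> coxeter_length I m (coxeter_prod I m is) = length is"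

definition reduced_string :: "'i set \<Rightarrow> ('i \<Rightarrow> 'i \<Rightarrow> enat) \<Rightarrow> (int \<Rightarrow> 'i) \<Rightarrow> bool" where
  "reduced_string I m \<sigma> \<longleftrightarrow> range \<sigma> \<subseteq> I \<and>
    (\<forall>s. \<forall>r::nat. coxeter_length I m (coxeter_prod I m (map \<sigma> [s..s + int r])) = r + 1)"

text \<open>The edges of the chamber graph are two-element sets of chambers.\<close>

definition adjacent :: "'c set set \<Rightarrow> ('c set \<Rightarrow> 'i) \<Rightarrow> 'i \<Rightarrow> 'c \<Rightarrow> 'c \<Rightarrow> bool" where
  "adjacent EC t i a b \<longleftrightarrow> {a, b} \<in> EC \<and> t {a, b} = i"

definition gallery ::
    "'c set \<Rightarrow> 'c set set \<Rightarrow> ('c set \<Rightarrow> 'i) \<Rightarrow> 'i list \<Rightarrow> 'c list \<Rightarrow> bool" where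
  "gallery C EC t is cs \<longleftrightarrow> cs \<in> lists C \<and> length cs = length is + 1 \<and>
    (\<forall>s<length is. adjacent EC t (is ! s) (cs ! s) (cs ! Suc s))"

definition infinite_gallery ::
    "'c set \<Rightarrow> 'c set set \<Rightarrow> ('c set \<Rightarrow> 'i) \<Rightarrow> (int \<Rightarrow> 'i) \<Rightarrow> (int \<Rightarrow> 'c) \<Rightarrow> bool" where
  "infinite_gallery C EC t \<sigma> c \<longleftrightarrow> range c \<subseteq> C \<and> (\<forall>s. adjacent EC t (\<sigma> s) (c (s - 1)) (c s))"

locale building = coxeter_matrix I m
  for I :: "'i set" and m :: "'i \<Rightarrow> 'i \<Rightarrow> enat" +
  fixes C :: "'c set" and EC :: "'c set set" and t :: "'c set \<Rightarrow> 'i"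
    and \<delta> :: "'c \<Rightarrow> 'c \<Rightarrow> 'i word set"
  assumes edges: "\<And>e. e \<in> EC \<Longrightarrow> e \<subseteq> C \<and> card e = 2"
    and colors: "t \<in> EC \<rightarrow> I"
    and distance: "\<And>a b. a \<in> C \<Longrightarrow> b \<in> C \<Longrightarrow> \<delta> a b \<in> carrier (coxeter_group I m)"
    and B1_exists: "\<And>a i. a \<in> C \<Longrightarrow> i \<in> I \<Longrightarrow> \<exists>b\<in>C. adjacent EC t i a b"
    and B1_transitive: "\<And>a b c i. a \<in> C \<Longrightarrow> b \<in> C \<Longrightarrow> c \<in> C \<Longrightarrow> i \<in> I \<Longrightarrow>
      adjacent EC t i a b \<Longrightarrow> adjacent EC t i a c \<Longrightarrow> c \<noteq> b \<Longrightarrow> adjacent EC t i b c"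
    and B2: "\<And>a b is. a \<in> C \<Longrightarrow> b \<in> C \<Longrightarrow> reduced_word I m is \<Longrightarrow>
      \<delta> a b = coxeter_prod I m is \<longleftrightarrow> (\<exists>cs. gallery C EC t is cs \<and> hd cs = a \<and> last cs = b)"

definition building_automorphism ::
    "'c set \<Rightarrow> 'c set set \<Rightarrow> ('c set \<Rightarrow> 'i) \<Rightarrow> ('c \<Rightarrow> 'c) \<Rightarrow> bool" where
  "building_automorphism C EC t f \<longleftrightarrow> bij_betw f C C \<and>
    (\<forall>a\<in>C. \<forall>b\<in>C. {f a, f b} \<in> EC \<longleftrightarrow> {a, b} \<in> EC) \<and>
    (\<forall>a\<in>C. \<forall>b\<in>C. {a, b} \<in> EC \<longrightarrow> t {f a, f b} = t {a, b})"

locale hausdorff_topological_group = group G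
  for G :: "('g, 'x) monoid_scheme" (structure) +
  fixes T :: "'g topology"
  assumes topspace: "topspace T = carrier G"
    and Hausdorff: "Hausdorff_space T"
    and continuous_mult: "continuous_map (prod_topology T T) T (\<lambda>(g, h). g \<otimes> h)"
    and continuous_inv: "continuous_map T T (\<lambda>g. inv g)"

definition continuous_action :: "'g topology \<Rightarrow> 'x topology \<Rightarrow> ('g \<Rightarrow> 'x \<Rightarrow> 'x) \<Rightarrow> bool" where
  "continuous_action T X \<phi> \<longleftrightarrow> continuous_map (prod_topology T X) X (\<lambda>(g, x). \<phi> g x)"

text \<open>The library's \<^const>\<open>proper_map\<close> does not include continuity.\<close>

definition proper_action :: "'g topology \<Rightarrow> 'x topology \<Rightarrow> ('g \<Rightarrow> 'x \<Rightarrow> 'x) \<Rightarrow> bool" where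
  "proper_action T X \<phi> \<longleftrightarrow> continuous_action T X \<phi> \<and>
    continuous_map (prod_topology T X) (prod_topology X X) (\<lambda>(g, x). (\<phi> g x, x)) \<and>
    proper_map (prod_topology T X) (prod_topology X X) (\<lambda>(g, x). (\<phi> g x, x))"

definition weyl_transitive ::
    "('g, 'x) monoid_scheme \<Rightarrow> 'c set \<Rightarrow> ('c \<Rightarrow> 'c \<Rightarrow> 'w) \<Rightarrow> ('g \<Rightarrow> 'c \<Rightarrow> 'c) \<Rightarrow> bool" where
  "weyl_transitive G C \<delta> \<phi> \<longleftrightarrow>
    (\<forall>a\<in>C. \<forall>b\<in>C. \<forall>a'\<in>C. \<forall>b'\<in>C. \<delta> a b = \<delta> a' b' \<longrightarrow>
      (\<exists>g\<in>carrier G. \<phi> g a = a' \<and> \<phi> g b = b'))"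

definition infinitely_weyl_transitive ::
    "('g, 'x) monoid_scheme \<Rightarrow> 'i set \<Rightarrow> ('i \<Rightarrow> 'i \<Rightarrow> enat) \<Rightarrow>
      'c set \<Rightarrow> 'c set set \<Rightarrow> ('c set \<Rightarrow> 'i) \<Rightarrow> ('g \<Rightarrow> 'c \<Rightarrow> 'c) \<Rightarrow> bool" where
  "infinitely_weyl_transitive G I m C EC t \<phi> \<longleftrightarrow>
    (\<forall>\<sigma> c c'. reduced_string I m \<sigma> \<longrightarrow>
      infinite_gallery C EC t \<sigma> c \<longrightarrow> infinite_gallery C EC t \<sigma> c' \<longrightarrow>
      (\<exists>g\<in>carrier G. \<forall>s. \<phi> g (c s) = c' s))"

end

theory Submission
  imports Defs
begin

text \<open>Both directions compare finite galleries of reduced type with infinite ones.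

  From infinite to finite: two chambers at distance \<open>w\<close> are the ends of a gallery whose type is
  a reduced word for \<open>w\<close>. In an infinite Coxeter group every reduced word is a segment of a
  reduced bi-infinite string (\<open>ex_reduced_string\<close>), and every gallery of that
  type extends to an infinite gallery of the type of the string, because every chamber has
  neighbours of every color (\<open>gallery_extends_to_infinite_gallery\<close>). An element of \<open>G\<close> that maps
  one extended gallery to the other in particular maps the given pair of chambers to the other.
  The extension of words rests on the exchange
  condition: if no letter could be added to a reduced word on the left, then every reduced word
  would be a prefix of another reduced word for the element that the given word represents
  (\<open>longest_word_prefix\<close>), so that the lengths would be bounded and \<open>W\<close> would be finite. The
  exchange condition is derived from the presentation by counting, modulo two, how often each
  reflection of \<open>W\<close> occurs in a word (\<open>odd_reflections_cong_rel\<close>).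

  From finite to infinite: for every \<open>n\<close> the ends \<open>c\<^bsub>-n\<^esub>\<close>, \<open>c\<^bsub>n\<^esub>\<close> and
  \<open>c'\<^bsub>-n\<^esub>\<close>, \<open>c'\<^bsub>n\<^esub>\<close> have the same distance, so some element of \<open>G\<close> maps the
  first pair to the second. A gallery of reduced type is determined by its type and its ends
  (\<open>reduced_gallery_unique\<close>), so this element maps \<open>c\<^bsub>s\<^esub>\<close> to \<open>c'\<^bsub>s\<^esub>\<close> whenever
  \<open>-n \<le> s \<le> n\<close>. Properness makes the set of \<open>g\<close> with \<open>g c\<^bsub>0\<^esub> = c'\<^bsub>0\<^esub>\<close>
  compact, and the sets of elements that work up to \<open>n\<close> are a decreasing sequence of nonempty
  closed subsets of it; a common element maps the whole gallery (\<open>proper_action_limit\<close>).\<close>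

section \<open>Elements of odd multiplicity in a list\<close>

definition odd_elements :: "'a list \<Rightarrow> 'a set" where
  "odd_elements xs = {x. odd (count_list xs x)}"

lemma odd_elements_subset: "odd_elements xs \<subseteq> set xs"
  by (auto simp: odd_elements_def intro: ccontr)

lemma odd_elements_distinct: "distinct xs \<Longrightarrow> odd_elements xs = set xs"
  by (induction xs) (auto simp: odd_elements_def)

lemma odd_elements_map:
  assumes "inj_on f (set xs)"
  shows "odd_elements (map f xs) = f ` odd_elements xs"
proof -
  have eq: "count_list (map f xs) (f x) = count_list xs x" if "x \<in> set xs" for x
    using assms that by (simp add: count_list_inj_map)
  show ?thesis
  proof (intro equalityI subsetI)
    fix y assume y: "y \<in> odd_elements (map f xs)"
    then obtain x where "x \<in> set xs" "y = f x" using odd_elements_subset by fastforce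
    then show "y \<in> f ` odd_elements xs" using y eq by (auto simp: odd_elements_def)
  next
    fix y assume "y \<in> f ` odd_elements xs"
    then show "y \<in> odd_elements (map f xs)"
      using eq odd_elements_subset[of xs] by (auto simp: odd_elements_def)
  qed
qed

section \<open>Words, products and reduced words in a Coxeter group\<close>

context coxeter_matrix
begin

abbreviation W where "W \<equiv> coxeter_group I m"
abbreviation gen where "gen \<equiv> coxeter_generator I m"
abbreviation word_prod where "word_prod \<equiv> coxeter_prod I m"
abbreviation rel where "rel \<equiv> presentation_rel I (coxeter_relators I m)"

sublocale W: group W
  unfolding coxeter_group_def by (rule group_presented_group)

lemma class_in_carrier: "u \<in> words I \<Longrightarrow> rel `` {u} \<in> carrier W"
  by (simp add: coxeter_group_def presented_group_def quotientI)

lemma class_append: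
  "u \<in> words I \<Longrightarrow> v \<in> words I \<Longrightarrow> rel `` {u @ v} = rel `` {u} \<otimes>\<^bsub>W\<^esub> rel `` {v}"
  by (simp add: coxeter_group_def presented_group_mult)

lemma class_Nil: "rel `` {[]} = \<one>\<^bsub>W\<^esub>"
  by (simp add: coxeter_group_def presented_group_def)

lemma gen_closed [simp]: "i \<in> I \<Longrightarrow> gen i \<in> carrier W"
  by (simp add: coxeter_generator_def class_in_carrier)

lemma word_prod_Nil [simp]: "word_prod [] = \<one>\<^bsub>W\<^esub>"
  by (simp add: coxeter_prod_def)

lemma word_prod_Cons [simp]: "word_prod (i # is) = gen i \<otimes>\<^bsub>W\<^esub> word_prod is"
  by (simp add: coxeter_prod_def)

lemma word_prod_closed [simp]: "is \<in> lists I \<Longrightarrow> word_prod is \<in> carrier W"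
  by (induction "is") auto

lemma word_prod_append:
  "is \<in> lists I \<Longrightarrow> js \<in> lists I \<Longrightarrow> word_prod (is @ js) = word_prod is \<otimes>\<^bsub>W\<^esub> word_prod js"
  by (induction "is") (auto simp: W.m_assoc)

lemma gen_square [simp]: "i \<in> I \<Longrightarrow> gen i \<otimes>\<^bsub>W\<^esub> gen i = \<one>\<^bsub>W\<^esub>"
proof -
  assume i: "i \<in> I"
  have "[(i, True), (i, True)] \<in> coxeter_relators I m"
    unfolding coxeter_relators_def using i diagonal[OF i]
    by (auto simp: one_enat_def intro!: exI[of _ i] exI[of _ "Suc 0"])
  then have "([] @ [(i, True), (i, True)] @ [], [] @ []) \<in> rel"
    using i by (intro presentation_rel.relator) auto
  then have "rel `` {[(i, True), (i, True)]} = \<one>\<^bsub>W\<^esub>"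
    using equiv_class_eq[OF equiv_presentation_rel] class_Nil by fastforce
  then show ?thesis
    using class_append[of "[(i, True)]" "[(i, True)]"] i by (simp add: coxeter_generator_def)
qed

lemma inv_gen [simp]: "i \<in> I \<Longrightarrow> inv\<^bsub>W\<^esub> gen i = gen i"
  by (simp add: W.inv_equality)

lemma class_letter: "i \<in> I \<Longrightarrow> rel `` {[(i, b)]} = gen i"
proof (cases b)
  case False
  assume i: "i \<in> I"
  have "([] @ [(i, False), (i, \<not> False)] @ [], [] @ []) \<in> rel"
    using i by (intro presentation_rel.cancel) auto
  then have "rel `` {[(i, False), (i, True)]} = \<one>\<^bsub>W\<^esub>"
    using equiv_class_eq[OF equiv_presentation_rel] class_Nil by fastforce
  then have "rel `` {[(i, False)]} \<otimes>\<^bsub>W\<^esub> gen i = \<one>\<^bsub>W\<^esub>"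
    using class_append[of "[(i, False)]" "[(i, True)]"] i by (simp add: coxeter_generator_def)
  then show ?thesis
    using W.inv_equality[of "rel `` {[(i, False)]}" "gen i"] i False
    by (simp add: class_in_carrier)
qed (simp add: coxeter_generator_def)

lemma class_eq_word_prod: "u \<in> words I \<Longrightarrow> rel `` {u} = word_prod (map fst u)"
proof (induction u)
  case (Cons x u)
  then show ?case
    using class_append[of "[x]" u] class_letter[of "fst x" "snd x"] by auto
qed (simp add: class_Nil)

lemma word_prod_eq_iff:
  assumes "is \<in> lists I" "js \<in> lists I"
  shows "word_prod is = word_prod js \<longleftrightarrow>
    (map (\<lambda>i. (i, True)) is, map (\<lambda>i. (i, True)) js) \<in> rel"
proof -
  have w: "map (\<lambda>i. (i, True)) ks \<in> words I" if "ks \<in> lists I" for ks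
    using that by (auto simp: in_lists_conv_set)
  show ?thesis
    using eq_equiv_class_iff[OF equiv_presentation_rel w[OF assms(1)] w[OF assms(2)],
        of "coxeter_relators I m"]
      class_eq_word_prod[OF w[OF assms(1)]] class_eq_word_prod[OF w[OF assms(2)]]
    by (simp add: comp_def)
qed

lemma ex_word_prod:
  assumes "w \<in> carrier W"
  shows "\<exists>is\<in>lists I. word_prod is = w"
proof -
  obtain u where "u \<in> words I" "w = rel `` {u}"
    using assms by (auto simp: coxeter_group_def presented_group_def quotient_def)
  then show ?thesis
    using class_eq_word_prod by (intro bexI[of _ "map fst u"]) (auto simp: in_lists_conv_set)
qed

lemma word_prod_rev: "is \<in> lists I \<Longrightarrow> word_prod (rev is) = inv\<^bsub>W\<^esub> word_prod is"
  by (induction "is") (simp_all add: word_prod_append W.inv_mult_group lists_eq_set)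

lemma reduced_word_iff:
  "reduced_word I m is \<longleftrightarrow>
    is \<in> lists I \<and> (\<forall>js\<in>lists I. word_prod js = word_prod is \<longrightarrow> length is \<le> length js)"
proof (cases "is \<in> lists I")
  case True
  let ?P = "\<lambda>n. \<exists>js\<in>lists I. length js = n \<and> word_prod js = word_prod is"
  have P: "?P (length is)" using True by blast
  have "(LEAST n. ?P n) = length is \<longleftrightarrow> (\<forall>n. ?P n \<longrightarrow> length is \<le> n)"
  proof
    assume L: "(LEAST n. ?P n) = length is"
    show "\<forall>n. ?P n \<longrightarrow> length is \<le> n"
      unfolding L[symmetric] by (intro allI impI Least_le)
  next
    assume "\<forall>n. ?P n \<longrightarrow> length is \<le> n"
    with P show "(LEAST n. ?P n) = length is" by (intro Least_equality) blast+
  qed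
  then show ?thesis
    using True unfolding reduced_word_def coxeter_length_def by blast
qed (simp add: reduced_word_def)

lemma ex_reduced_word:
  assumes "w \<in> carrier W"
  shows "\<exists>is. reduced_word I m is \<and> word_prod is = w"
proof -
  obtain "is" where "is \<in> lists I \<and> word_prod is = w"
    using ex_word_prod assms by blast
  from ex_has_least_nat[of "\<lambda>is. is \<in> lists I \<and> word_prod is = w", OF this, of length]
  obtain js where "js \<in> lists I" "word_prod js = w"
    "\<And>ks. ks \<in> lists I \<Longrightarrow> word_prod ks = w \<Longrightarrow> length js \<le> length ks"
    by blast
  then show ?thesis unfolding reduced_word_iff by blast
qed

lemma reduced_word_in_lists: "reduced_word I m is \<Longrightarrow> is \<in> lists I"
  by (simp add: reduced_word_def)

text \<open>A shorter word for the middle part could be substituted in the whole word.\<close>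

lemma reduced_word_infix:
  assumes "reduced_word I m (us @ vs @ ws)"
  shows "reduced_word I m vs"
proof -
  have l: "us \<in> lists I" "vs \<in> lists I" "ws \<in> lists I"
    using assms by (auto simp: reduced_word_def)
  have "length vs \<le> length js" if "js \<in> lists I" "word_prod js = word_prod vs" for js
  proof -
    have "word_prod (us @ js @ ws) = word_prod (us @ vs @ ws)"
      using that l by (simp add: word_prod_append)
    then have "length (us @ vs @ ws) \<le> length (us @ js @ ws)"
      using assms that l unfolding reduced_word_iff
      by (metis append_in_lists_conv)
    then show ?thesis by simp
  qed
  then show ?thesis using l by (simp add: reduced_word_iff)
qed

lemma reduced_word_rev:
  assumes "reduced_word I m is"
  shows "reduced_word I m (rev is)"
proof -
  have l: "is \<in> lists I" using assms by (rule reduced_word_in_lists)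
  have "length is \<le> length js" if "js \<in> lists I" "word_prod js = word_prod (rev is)" for js
  proof -
    have "word_prod (rev js) = word_prod is"
      using that l by (simp add: word_prod_rev)
    moreover have "rev js \<in> lists I" using that by auto
    ultimately have "length is \<le> length (rev js)"
      using assms unfolding reduced_word_iff by blast
    then show ?thesis by simp
  qed
  then show ?thesis using l unfolding reduced_word_iff by auto
qed

section \<open>Reflections and the exchange condition\<close>

definition conjugate where "conjugate x y = x \<otimes>\<^bsub>W\<^esub> y \<otimes>\<^bsub>W\<^esub> inv\<^bsub>W\<^esub> x"

text \<open>For a word \<open>i\<^sub>1 \<cdots> i\<^sub>k\<close> these are the elements
  \<open>i\<^sub>1 \<cdots> i\<^sub>r \<cdots> i\<^sub>1\<close> for \<open>r = 1, \<dots>, k\<close>. Geometrically they are the reflections in the walls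
  that a gallery of this type crosses in the Coxeter complex.\<close>

primrec reflections where
  "reflections [] = []"
| "reflections (i # is) = gen i # map (conjugate (gen i)) (reflections is)"

lemma conjugate_closed [simp]:
  "x \<in> carrier W \<Longrightarrow> y \<in> carrier W \<Longrightarrow> conjugate x y \<in> carrier W"
  by (simp add: conjugate_def)

lemma conjugate_conjugate:
  "x \<in> carrier W \<Longrightarrow> y \<in> carrier W \<Longrightarrow> z \<in> carrier W \<Longrightarrow>
    conjugate x (conjugate y z) = conjugate (x \<otimes>\<^bsub>W\<^esub> y) z"
  by (simp add: conjugate_def W.inv_mult_group W.m_assoc)

lemma conjugate_one [simp]: "y \<in> carrier W \<Longrightarrow> conjugate \<one>\<^bsub>W\<^esub> y = y"
  by (simp add: conjugate_def)

lemma inj_on_conjugate: "x \<in> carrier W \<Longrightarrow> inj_on (conjugate x) (carrier W)"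
  by (rule inj_onI) (simp add: conjugate_def)

lemma reflections_closed: "is \<in> lists I \<Longrightarrow> set (reflections is) \<subseteq> carrier W"
  by (induction "is") auto

lemma length_reflections [simp]: "length (reflections is) = length is"
  by (induction "is") auto

lemma reflections_append:
  assumes "is \<in> lists I" "js \<in> lists I"
  shows "reflections (is @ js) = reflections is @ map (conjugate (word_prod is)) (reflections js)"
  using assms(1)
proof (induction "is")
  case Nil
  then show ?case
    using reflections_closed[OF assms(2)] by (auto intro!: map_idI[symmetric])
next
  case (Cons i "is")
  then show ?case
    using reflections_closed[OF assms(2)]
    by (simp add: lists_eq_set conjugate_conjugate subset_iff)
qed

text \<open>The reflection \<open>i\<^sub>1 \<cdots> i\<^sub>r \<cdots> i\<^sub>1\<close> times \<open>i\<^sub>1 \<cdots> i\<^sub>k\<close> is the word with \<open>i\<^sub>r\<close>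
  deleted. This turns a statement about reflections into one about shorter words.\<close>

lemma delete_letter:
  assumes "is \<in> lists I" "x \<in> set (reflections is)"
  shows "\<exists>js\<in>lists I. length is = Suc (length js) \<and> x \<otimes>\<^bsub>W\<^esub> word_prod is = word_prod js"
  using assms
proof (induction "is" arbitrary: x)
  case (Cons i "is")
  then have i: "i \<in> I" "is \<in> lists I" by auto
  consider "x = gen i" | y where "y \<in> set (reflections is)" "x = conjugate (gen i) y"
    using Cons.prems by auto
  then show ?case
  proof cases
    case 1
    then show ?thesis using i
      by (intro bexI[of _ "is"]) (auto simp: W.m_assoc[symmetric])
  next
    case 2
    then obtain js where js: "js \<in> lists I" "length is = Suc (length js)"
      "y \<otimes>\<^bsub>W\<^esub> word_prod is = word_prod js" using Cons.IH i by blast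
    have y: "y \<in> carrier W" using 2 reflections_closed i by auto
    have "x \<otimes>\<^bsub>W\<^esub> word_prod (i # is) =
        gen i \<otimes>\<^bsub>W\<^esub> (y \<otimes>\<^bsub>W\<^esub> ((gen i \<otimes>\<^bsub>W\<^esub> gen i) \<otimes>\<^bsub>W\<^esub> word_prod is))"
      using i y by (simp add: 2 conjugate_def W.m_assoc del: gen_square)
    then have "x \<otimes>\<^bsub>W\<^esub> word_prod (i # is) = word_prod (i # js)"
      using i y js by simp
    then show ?thesis using i js by (intro bexI[of _ "i # js"]) auto
  qed
qed simp

text \<open>If a wall is crossed twice, then the part of the path between the two crossings can be
  reflected back; on words, the two letters concerned are deleted.\<close>

lemma not_distinct_reflections:
  assumes "is \<in> lists I" "\<not> distinct (reflections is)"
  shows "\<exists>js\<in>lists I. length js < length is \<and> word_prod js = word_prod is"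
  using assms
proof (induction "is")
  case (Cons i "is")
  then have i: "i \<in> I" "is \<in> lists I" by auto
  have "distinct (map (conjugate (gen i)) (reflections is)) \<longleftrightarrow> distinct (reflections is)"
    using inj_on_subset[OF inj_on_conjugate reflections_closed] i
    by (simp add: distinct_map)
  then consider "gen i \<in> conjugate (gen i) ` set (reflections is)"
    | "\<not> distinct (reflections is)" using Cons.prems by auto
  then show ?case
  proof cases
    case 1
    then obtain y where y: "y \<in> set (reflections is)" "gen i = conjugate (gen i) y" by auto
    \<comment> \<open>The reflection \<open>i\<close> of the first letter is fixed by conjugation with \<open>i\<close>. It thus already
      occurs among the reflections of \<open>is\<close>, and left multiplication by it deletes a letter there.\<close>
    have "conjugate (gen i) y = conjugate (gen i) (gen i)"
      using y i by (simp add: conjugate_def)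
    then have "y = gen i"
      using inj_onD[OF inj_on_conjugate[of "gen i"], of y "gen i"] reflections_closed[of "is"] y i
      by (simp add: subset_iff)
    then obtain js where "js \<in> lists I" "length is = Suc (length js)"
      "gen i \<otimes>\<^bsub>W\<^esub> word_prod is = word_prod js" using delete_letter i y by metis
    then show ?thesis by (intro bexI[of _ js]) auto
  next
    case 2
    then obtain js where "js \<in> lists I" "length js < length is" "word_prod js = word_prod is"
      using Cons.IH i by blast
    then show ?thesis using i by (intro bexI[of _ "i # js"]) auto
  qed
qed simp

text \<open>Inserting \<open>r\<close> into a word adds conjugates of the reflections of \<open>r\<close>, each an even number of
  times, and does not change the other reflections since \<open>r\<close> represents the identity.\<close>

lemma odd_reflections_cancel:
  assumes "u \<in> lists I" "r \<in> lists I" "v \<in> lists I"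
    and one: "word_prod r = \<one>\<^bsub>W\<^esub>" and even: "odd_elements (reflections r) = {}"
  shows "odd_elements (reflections (u @ r @ v)) = odd_elements (reflections (u @ v))"
proof -
  let ?c = "conjugate (word_prod u)"
  have "inj_on ?c (set (reflections r))"
    using inj_on_subset[OF inj_on_conjugate reflections_closed] assms by simp
  then have "odd_elements (map ?c (reflections r)) = {}"
    using even by (simp add: odd_elements_map)
  moreover have "word_prod (u @ r) = word_prod u"
    using assms by (simp add: word_prod_append)
  then have "reflections ((u @ r) @ v) =
      (reflections u @ map ?c (reflections r)) @ map ?c (reflections v)"
    using assms by (simp only: reflections_append append_in_lists_conv)
  ultimately show ?thesis
    using reflections_append[of u v] assms by (simp add: odd_elements_def)
qed

text \<open>The \<open>r\<close>-th reflection of the alternating word \<open>i j i j \<cdots>\<close> is itself an alternating word of odd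
  length \<open>2r - 1\<close>, that is \<open>(i j)\<^sup>k i\<close> with \<open>k = r - 1\<close>.\<close>

lemma reflections_dihedral:
  assumes i: "i \<in> I" and j: "j \<in> I"
  shows "reflections (concat (replicate n [i, j])) =
    map (\<lambda>k. (gen i \<otimes>\<^bsub>W\<^esub> gen j) [^]\<^bsub>W\<^esub> k \<otimes>\<^bsub>W\<^esub> gen i) [0..<2 * n]"
proof (induction n)
  case (Suc n)
  let ?a = "gen i" and ?b = "gen j"
  let ?r = "\<lambda>k::nat. (?a \<otimes>\<^bsub>W\<^esub> ?b) [^]\<^bsub>W\<^esub> k \<otimes>\<^bsub>W\<^esub> ?a"
  let ?w = "concat (replicate n [i, j])"
  have w: "?w \<in> lists I" using i j by (induction n) auto
  have ab: "?a \<otimes>\<^bsub>W\<^esub> ?b \<in> carrier W" using i j by simp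
  have "conjugate (?a \<otimes>\<^bsub>W\<^esub> ?b) (?r k) = ?r (Suc (Suc k))" for k
  proof -
    have "conjugate (?a \<otimes>\<^bsub>W\<^esub> ?b) (?r k) =
        (?a \<otimes>\<^bsub>W\<^esub> ?b) \<otimes>\<^bsub>W\<^esub> (?a \<otimes>\<^bsub>W\<^esub> ?b) [^]\<^bsub>W\<^esub> k \<otimes>\<^bsub>W\<^esub> (?a \<otimes>\<^bsub>W\<^esub> ?b) \<otimes>\<^bsub>W\<^esub> ?a"
      using i j by (simp add: conjugate_def W.inv_mult_group W.m_assoc)
    also have "\<dots> = ?r (Suc (Suc k))"
      using W.nat_pow_Suc2[OF ab, of k] by simp
    finally show ?thesis .
  qed
  moreover have "conjugate ?a ?b = ?r 1"
    using i j by (simp add: conjugate_def)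
  moreover have "[0..<2 * Suc n] = 0 # 1 # map (\<lambda>k. Suc (Suc k)) [0..<2 * n]"
    by (simp add: upt_conv_Cons map_Suc_upt[symmetric] comp_def del: upt_Suc map_Suc_upt)
  ultimately show ?case
    using reflections_append[of "[i, j]" ?w] w i j Suc.IH by (simp add: comp_def)
qed simp

lemma word_prod_dihedral:
  "i \<in> I \<Longrightarrow> j \<in> I \<Longrightarrow>
    word_prod (concat (replicate n [i, j])) = (gen i \<otimes>\<^bsub>W\<^esub> gen j) [^]\<^bsub>W\<^esub> n"
proof (induction n)
  case (Suc n)
  then show ?case
    using W.nat_pow_Suc2[of "gen i \<otimes>\<^bsub>W\<^esub> gen j" n] by (simp add: W.m_assoc)
qed simp

lemma word_prod_eq_of_rel:
  assumes "(u, v) \<in> rel"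
  shows "word_prod (map fst u) = word_prod (map fst v)"
  using equiv_class_eq[OF equiv_presentation_rel assms] presentation_rel_words[OF assms]
  by (simp add: class_eq_word_prod)

text \<open>The parity with which a reflection occurs in a word depends only on the group element. It suffices
  to look at the defining relations. In a relator \<open>(i j)\<^sup>n\<close> the reflections
  \<open>(i j)\<^sup>k i\<close> for \<open>k < 2n\<close> repeat with period \<open>n\<close>, hence each occurs an even number of
  times. This is Bourbaki's action of \<open>W\<close> on signed reflections, stated for words.\<close>

lemma odd_reflections_cong_rel:
  assumes "(u, v) \<in> rel"
  shows "odd_elements (reflections (map fst u)) = odd_elements (reflections (map fst v))"
  using assms
proof (induction rule: presentation_rel.induct)
  case (cancel u v s b)
  have "odd_elements (reflections [s, s]) = {}"
    using cancel(3) by (simp add: odd_elements_def conjugate_def)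
  then have "odd_elements (reflections (map fst u @ [s, s] @ map fst v)) =
      odd_elements (reflections (map fst u @ map fst v))"
    using cancel by (intro odd_reflections_cancel) (auto simp: in_lists_conv_set)
  then show ?case by simp
next
  case (relator u v r)
  then obtain i j n where r: "r = concat (replicate n [(i, True), (j, True)])"
    and ij: "i \<in> I" "j \<in> I" by (auto simp: coxeter_relators_def)
  let ?w = "concat (replicate n [i, j])"
  let ?ab = "gen i \<otimes>\<^bsub>W\<^esub> gen j"
  have fst_r: "map fst r = ?w" unfolding r by (simp add: map_concat)
  have "(r, []) \<in> rel"
    using presentation_rel.relator[of "[]" I "[]" r "coxeter_relators I m"] relator by simp
  then have one: "word_prod ?w = \<one>\<^bsub>W\<^esub>"
    using word_prod_eq_of_rel fst_r by fastforce
  then have pow: "?ab [^]\<^bsub>W\<^esub> n = \<one>\<^bsub>W\<^esub>"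
    using ij by (simp add: word_prod_dihedral)
  have ab: "?ab \<in> carrier W" using ij by simp
  have "?ab [^]\<^bsub>W\<^esub> (k + n) = ?ab [^]\<^bsub>W\<^esub> k" for k
    using W.nat_pow_mult[OF ab, of k n, symmetric] ab by (simp add: pow)
  moreover have "[0..<2 * n] = [0..<n] @ map (\<lambda>k. k + n) [0..<n]"
    using upt_add_eq_append[of 0 n n] by (simp add: map_add_upt mult_2)
  ultimately have "odd_elements (reflections ?w) = {}"
    using ij by (simp add: reflections_dihedral odd_elements_def comp_def)
  then have "odd_elements (reflections (map fst u @ ?w @ map fst v)) =
      odd_elements (reflections (map fst u @ map fst v))"
    using relator ij one
    by (intro odd_reflections_cancel) (auto simp: in_lists_conv_set)
  then show ?case by (simp add: fst_r)
qed simp_all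

text \<open>If all reflections of a word are distinct, then they are exactly the ones of odd multiplicity.
  Their number is thus the length of the word, and every other word for the same element
  needs at least as many letters to produce them.\<close>

lemma reduced_word_iff_distinct_reflections:
  assumes "is \<in> lists I"
  shows "reduced_word I m is \<longleftrightarrow> distinct (reflections is)"
proof
  assume "reduced_word I m is"
  then show "distinct (reflections is)"
    using not_distinct_reflections[OF assms] by (auto simp: reduced_word_iff not_le[symmetric])
next
  assume d: "distinct (reflections is)"
  have "length is \<le> length js" if js: "js \<in> lists I" "word_prod js = word_prod is" for js
  proof -
    have "odd_elements (reflections js) = odd_elements (reflections is)"
      using odd_reflections_cong_rel[of "map (\<lambda>i. (i, True)) js" "map (\<lambda>i. (i, True)) is"]
        word_prod_eq_iff[OF js(1) assms] js(2) by (simp add: comp_def)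
    also have "\<dots> = set (reflections is)"
      using d by (simp add: odd_elements_distinct)
    finally have "length is = card (odd_elements (reflections js))"
      using d by (simp add: distinct_card)
    also have "\<dots> \<le> card (set (reflections js))"
      by (intro card_mono odd_elements_subset) simp
    also have "\<dots> \<le> length js"
      using card_length[of "reflections js"] by simp
    finally show ?thesis .
  qed
  then show "reduced_word I m is" using assms by (simp add: reduced_word_iff)
qed

text \<open>The reflections of \<open>i # is\<close> are \<open>i\<close> and the conjugates by \<open>i\<close> of those of \<open>is\<close>. The latter are
  distinct, so the only possible repetition is between \<open>i\<close> and one of them. With
  \<open>delete_letter\<close> this is the exchange condition.\<close>

lemma generator_in_reflections:
  assumes "reduced_word I m is" "i \<in> I" "\<not> reduced_word I m (i # is)"
  shows "gen i \<in> set (reflections is)"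
proof -
  have l: "is \<in> lists I" using assms(1) by (rule reduced_word_in_lists)
  have "distinct (map (conjugate (gen i)) (reflections is))"
    using inj_on_subset[OF inj_on_conjugate reflections_closed[OF l]] assms l
    by (simp add: distinct_map reduced_word_iff_distinct_reflections)
  then obtain y where y: "y \<in> set (reflections is)" "gen i = conjugate (gen i) y"
    using assms l by (auto simp: reduced_word_iff_distinct_reflections)
  moreover have "conjugate (gen i) (gen i) = gen i"
    using assms(2) by (simp add: conjugate_def)
  ultimately show ?thesis
    using inj_onD[OF inj_on_conjugate[of "gen i"], of y "gen i"] reflections_closed[OF l] assms(2)
    by (simp add: subset_iff)
qed

text \<open>A reduced word that admits no further letter on the left represents a longest element. The
  prefix is built up from its last letter to its first: the letter \<open>i\<close> is exchanged against a letter of the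
  reduced word \<open>us @ vs\<close>, and this letter lies in \<open>vs\<close>, since otherwise \<open>i # us\<close> would not be
  reduced.\<close>

lemma longest_word_prefix:
  assumes red: "reduced_word I m is"
    and longest: "\<And>i. i \<in> I \<Longrightarrow> \<not> reduced_word I m (i # is)"
    and us: "reduced_word I m us"
  shows "\<exists>vs. reduced_word I m (us @ vs) \<and> word_prod (us @ vs) = word_prod is"
  using us
proof (induction us)
  case Nil
  then show ?case using red by (intro exI[of _ "is"]) simp
next
  case (Cons i us)
  have l: "i \<in> I" "us \<in> lists I"
    using reduced_word_in_lists[OF Cons.prems] by auto
  have "reduced_word I m us"
    using reduced_word_infix[of "[i]" us "[]"] Cons.prems by simp
  then obtain vs where vs: "reduced_word I m (us @ vs)" "word_prod (us @ vs) = word_prod is"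
    using Cons.IH by blast
  have vl: "vs \<in> lists I" using reduced_word_in_lists[OF vs(1)] by simp
  have len: "length (us @ vs) = length is"
    using vs red l vl reduced_word_in_lists[OF red] unfolding reduced_word_iff
    by (metis le_antisym)
  have "\<not> reduced_word I m (i # us @ vs)"
  proof
    assume "reduced_word I m (i # us @ vs)"
    moreover have "word_prod (i # is) = word_prod (i # us @ vs)" using vs(2) by simp
    ultimately have "reduced_word I m (i # is)"
      using l len reduced_word_in_lists[OF red] unfolding reduced_word_iff by simp
    then show False using longest l(1) by blast
  qed
  then have "gen i \<in> set (reflections (us @ vs))"
    by (rule generator_in_reflections[OF vs(1) l(1)])
  moreover have "gen i \<notin> set (reflections us)"
  proof
    assume "gen i \<in> set (reflections us)"
    then obtain js where "js \<in> lists I" "length us = Suc (length js)"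
      "word_prod (i # us) = word_prod js" using delete_letter l by (metis word_prod_Cons)
    then show False using Cons.prems by (auto simp: reduced_word_iff)
  qed
  ultimately obtain y where y: "y \<in> set (reflections vs)" "gen i = conjugate (word_prod us) y"
    using l vl by (auto simp: reflections_append)
  obtain ws where ws: "ws \<in> lists I" "length vs = Suc (length ws)"
    "y \<otimes>\<^bsub>W\<^esub> word_prod vs = word_prod ws"
    using delete_letter vl y by blast
  have yc: "y \<in> carrier W" using reflections_closed vl y by blast
  have swap: "gen i \<otimes>\<^bsub>W\<^esub> word_prod us = word_prod us \<otimes>\<^bsub>W\<^esub> y"
    using l yc by (simp add: y(2) conjugate_def W.m_assoc)
  have swap_vs: "word_prod us \<otimes>\<^bsub>W\<^esub> (y \<otimes>\<^bsub>W\<^esub> word_prod vs) =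
      gen i \<otimes>\<^bsub>W\<^esub> (word_prod us \<otimes>\<^bsub>W\<^esub> word_prod vs)"
    using l yc vl swap by (simp add: W.m_assoc[symmetric])
  have "gen i \<otimes>\<^bsub>W\<^esub> word_prod (us @ ws) = (gen i \<otimes>\<^bsub>W\<^esub> word_prod us) \<otimes>\<^bsub>W\<^esub> word_prod ws"
    using l ws by (simp add: word_prod_append W.m_assoc)
  also have "\<dots> = (gen i \<otimes>\<^bsub>W\<^esub> (gen i \<otimes>\<^bsub>W\<^esub> word_prod us)) \<otimes>\<^bsub>W\<^esub> word_prod vs"
    using l yc vl swap_vs by (simp add: ws(3)[symmetric] W.m_assoc)
  also have "\<dots> = word_prod is"
    using l vl vs(2) by (simp add: word_prod_append W.m_assoc[symmetric])
  finally have "word_prod (i # us @ ws) = word_prod is" by simp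
  moreover from this have "reduced_word I m ((i # us) @ ws)"
    using red l ws len by (simp add: reduced_word_iff)
  ultimately show ?case by (intro exI[of _ ws]) simp
qed

text \<open>Otherwise every element of \<open>W\<close> would have a word no longer than \<open>is\<close> over the finite
  alphabet \<open>I\<close>.\<close>

lemma reduced_word_Cons_ex:
  assumes inf: "infinite (carrier W)" and red: "reduced_word I m is"
  shows "\<exists>i\<in>I. reduced_word I m (i # is)"
proof (rule ccontr)
  assume "\<not> ?thesis"
  then have longest: "\<And>i. i \<in> I \<Longrightarrow> \<not> reduced_word I m (i # is)" by blast
  have "carrier W \<subseteq> word_prod ` {us. set us \<subseteq> I \<and> length us \<le> length is}"
  proof
    fix w assume "w \<in> carrier W"
    then obtain us where us: "reduced_word I m us" "word_prod us = w"
      using ex_reduced_word by blast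
    obtain vs where "reduced_word I m (us @ vs)" "word_prod (us @ vs) = word_prod is"
      using longest_word_prefix[OF red longest us(1)] by blast
    then have "length (us @ vs) \<le> length is"
      using reduced_word_in_lists[OF red] by (auto simp: reduced_word_iff)
    moreover have "set us \<subseteq> I" using reduced_word_in_lists[OF us(1)] by auto
    ultimately show "w \<in> word_prod ` {us. set us \<subseteq> I \<and> length us \<le> length is}"
      using us(2) by auto
  qed
  then show False
    using inf finite_lists_length_le[OF finite] finite_surj by blast
qed

lemma reduced_word_extend_both:
  assumes inf: "infinite (carrier W)" and red: "reduced_word I m is"
  shows "\<exists>i j. reduced_word I m (i # is @ [j])"
proof -
  obtain i where "reduced_word I m (i # is)"
    using reduced_word_Cons_ex[OF assms] by blast
  then have "reduced_word I m (rev (i # is))" by (rule reduced_word_rev)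
  then obtain j where "reduced_word I m (j # rev (i # is))"
    using reduced_word_Cons_ex[OF inf] by blast
  then have "reduced_word I m (rev (j # rev (i # is)))" by (rule reduced_word_rev)
  then show ?thesis by auto
qed

section \<open>Reduced bi-infinite strings\<close>

lemma reduced_string_imp_reduced_word:
  assumes "reduced_string I m \<sigma>"
  shows "reduced_word I m (map \<sigma> [a..b])"
proof (cases "a \<le> b")
  case True
  define r where "r = nat (b - a)"
  have b: "b = a + int r" using True by (simp add: r_def)
  have "map \<sigma> [a..b] \<in> lists I"
    using assms by (auto simp: reduced_string_def in_lists_conv_set)
  moreover have "coxeter_length I m (word_prod (map \<sigma> [a..b])) = r + 1"
    using assms unfolding b reduced_string_def by blast
  moreover have "length (map \<sigma> [a..b]) = r + 1" by (simp add: b)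
  ultimately show ?thesis by (simp add: reduced_word_def)
qed (simp add: reduced_word_iff)

text \<open>Adding one letter at each end again and again exhausts \<open>\<int>\<close>, and the letter at a given position
  never changes after it has been added. Every finite segment of the limit is an infix of one of
  the reduced words.\<close>

lemma ex_reduced_string:
  assumes inf: "infinite (carrier W)" and red: "reduced_word I m is"
  shows "\<exists>\<sigma>. reduced_string I m \<sigma> \<and> (\<forall>k<length is. \<sigma> (int k + 1) = is ! k)"
proof -
  let ?L = "length is"
  have "\<exists>X. \<forall>n. (reduced_word I m (X n) \<and> (n = 0 \<longrightarrow> X n = is)) \<and>
      (\<exists>i j. X (Suc n) = i # X n @ [j])"
  proof (rule dependent_nat_choice)
    show "\<exists>w. reduced_word I m w \<and> ((0::nat) = 0 \<longrightarrow> w = is)" using red by blast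
    fix w and n :: nat assume "reduced_word I m w \<and> (n = 0 \<longrightarrow> w = is)"
    then obtain i j where "reduced_word I m (i # w @ [j])"
      using reduced_word_extend_both[OF inf] by blast
    then show "\<exists>w'. (reduced_word I m w' \<and> (Suc n = 0 \<longrightarrow> w' = is)) \<and> (\<exists>i j. w' = i # w @ [j])"
      by auto
  qed
  then obtain X where X0: "X 0 = is" and Xred: "\<And>n. reduced_word I m (X n)"
    and XSuc: "\<And>n. \<exists>i j. X (Suc n) = i # X n @ [j]" by blast
  have len: "length (X n) = ?L + 2 * n" for n
  proof (induction n)
    case (Suc n)
    then show ?case using XSuc[of n] by auto
  qed (simp add: X0)
  have shift: "X (n + k) ! (q + k) = X n ! q" if "q < length (X n)" for n k q
  proof (induction k)
    case (Suc k)
    have "q + k < length (X (n + k))" using that by (simp add: len)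
    then show ?case using Suc XSuc[of "n + k"] by (auto simp: nth_append)
  qed simp
  \<comment> \<open>The word \<open>X n\<close> occupies the positions from \<open>1 - n\<close> to \<open>length is + n\<close>. The stage
    \<open>n = \<bar>p\<bar> + 1\<close> contains the position \<open>p\<close>.\<close>
  define \<sigma> where "\<sigma> p = X (Suc (nat \<bar>p\<bar>)) ! nat (p + int (nat \<bar>p\<bar>))" for p :: int
  have \<sigma>: "\<sigma> p = X n ! nat (p - 1 + int n)" if "1 - int n \<le> p" "p \<le> int ?L + int n" for p n
  proof -
    let ?N = "Suc (nat \<bar>p\<bar>)"
    have "\<sigma> p = X (?N + n) ! (nat (p + int (nat \<bar>p\<bar>)) + n)"
      unfolding \<sigma>_def by (rule shift[symmetric]) (simp add: len)
    also have "nat (p + int (nat \<bar>p\<bar>)) + n = nat (p - 1 + int n) + ?N"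
      using that by simp
    also have "X (?N + n) ! \<dots> = X n ! nat (p - 1 + int n)"
      using shift[of "nat (p - 1 + int n)" n ?N] that by (simp add: len add.commute)
    finally show ?thesis .
  qed
  have map_\<sigma>: "map \<sigma> [1 - int n..int ?L + int n] = X n" for n
  proof (rule nth_equalityI)
    show l: "length (map \<sigma> [1 - int n..int ?L + int n]) = length (X n)"
      by (simp add: len)
    fix k assume "k < length (map \<sigma> [1 - int n..int ?L + int n])"
    then show "map \<sigma> [1 - int n..int ?L + int n] ! k = X n ! k"
      using \<sigma>[of n "1 - int n + int k"] by (simp add: nth_upto)
  qed
  have window: "reduced_word I m (map \<sigma> [s..s + int r])" for s r
  proof -
    define n where "n = Suc (nat \<bar>s\<bar> + r)"
    have "[1 - int n..int ?L + int n] =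
        [1 - int n..s - 1] @ [s..s + int r] @ [s + int r + 1..int ?L + int n]"
      using upto_split1[of "1 - int n" s "int ?L + int n"]
        upto_split2[of s "s + int r" "int ?L + int n"] by (simp add: n_def)
    then show ?thesis
      using Xred[of n] map_\<sigma>[of n]
        reduced_word_infix[of "map \<sigma> [1 - int n..s - 1]" "map \<sigma> [s..s + int r]"
          "map \<sigma> [s + int r + 1..int ?L + int n]"] by simp
  qed
  have "\<sigma> p \<in> I" for p
    using reduced_word_in_lists[OF window[of p 0]] by simp
  then have "reduced_string I m \<sigma>"
    using window by (auto simp: reduced_string_def reduced_word_def)
  moreover have "\<forall>k<?L. \<sigma> (int k + 1) = is ! k"
    using \<sigma>[of 0] by (simp add: X0)
  ultimately show ?thesis by blast
qed

end

section \<open>Galleries\<close>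

context building
begin

lemma adjacent_sym: "adjacent EC t i a b \<longleftrightarrow> adjacent EC t i b a"
  by (simp add: adjacent_def insert_commute)

lemma gallery_Cons:
  "gallery C EC t (i # is) cs \<longleftrightarrow>
    (\<exists>a ds. cs = a # ds \<and> a \<in> C \<and> adjacent EC t i a (hd ds) \<and> gallery C EC t is ds)"
proof (cases cs)
  case (Cons a ds)
  then show ?thesis
    by (cases ds) (auto simp: gallery_def All_less_Suc2)
qed (simp add: gallery_def)

lemma gallery_ends_in: "gallery C EC t is cs \<Longrightarrow> hd cs \<in> C \<and> last cs \<in> C"
  by (cases cs) (auto simp: gallery_def in_lists_conv_set)

lemma gallery_distance:
  assumes "reduced_word I m is" "gallery C EC t is cs"
  shows "\<delta> (hd cs) (last cs) = coxeter_prod I m is"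
  using B2[OF _ _ assms(1)] assms(2) gallery_ends_in[OF assms(2)] by blast

text \<open>If two such galleries had different second chambers, then those would be \<open>i\<close>-adjacent to
  each other, where \<open>i\<close> is the first letter. Going from the one to the other and then along the
  second gallery gives a gallery of the full reduced type, while the first gallery gives one of the type
  without \<open>i\<close>. The distance would then have two different lengths.\<close>

lemma reduced_gallery_unique:
  assumes "reduced_word I m is" "gallery C EC t is cs" "gallery C EC t is cs'"
    and "hd cs = hd cs'" "last cs = last cs'"
  shows "cs = cs'"
  using assms
proof (induction "is" arbitrary: cs cs')
  case Nil
  then show ?case by (auto simp: gallery_def length_Suc_conv)
next
  case (Cons i "is")
  obtain a ds ds' where cs: "cs = a # ds" "cs' = a # ds'" "a \<in> C"
    and adj: "adjacent EC t i a (hd ds)" "adjacent EC t i a (hd ds')"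
    and gal: "gallery C EC t is ds" "gallery C EC t is ds'"
    using Cons.prems by (auto simp: gallery_Cons)
  have ne: "ds \<noteq> []" "ds' \<noteq> []" using gal by (auto simp: gallery_def)
  have red: "reduced_word I m is"
    using reduced_word_infix[of "[i]" "is" "[]"] Cons.prems(1) by simp
  have last: "last ds = last ds'" using Cons.prems ne cs by simp
  have i: "i \<in> I" using reduced_word_in_lists[OF Cons.prems(1)] by simp
  have "hd ds = hd ds'"
  proof (rule ccontr)
    assume neq: "hd ds \<noteq> hd ds'"
    have "adjacent EC t i (hd ds) (hd ds')"
      using B1_transitive[OF cs(3) _ _ i adj] gallery_ends_in gal neq by metis
    then have "gallery C EC t (i # is) (hd ds # ds')"
      using gallery_ends_in gal by (auto simp: gallery_Cons)
    then have "\<delta> (hd ds) (last ds) = coxeter_prod I m (i # is)"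
      using gallery_distance[OF Cons.prems(1)] ne last by fastforce
    then have "coxeter_prod I m (i # is) = coxeter_prod I m is"
      using gallery_distance[OF red gal(1)] by simp
    then show False
      using Cons.prems(1) reduced_word_in_lists[OF red] by (auto simp: reduced_word_iff)
  qed
  then show ?case using Cons.IH[OF red gal _ last] cs by simp
qed

lemma gallery_automorphism:
  assumes "building_automorphism C EC t f" "gallery C EC t is cs"
  shows "gallery C EC t is (map f cs)"
proof -
  have "f ` C = C" using assms(1) by (simp add: building_automorphism_def bij_betw_def)
  moreover have "adjacent EC t i (f a) (f b)" if "a \<in> C" "b \<in> C" "adjacent EC t i a b" for i a b
    using assms(1) that by (auto simp: building_automorphism_def adjacent_def)
  ultimately show ?thesis
    using assms(2) by (auto simp: gallery_def in_lists_conv_set)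
qed

lemma infinite_gallery_window:
  assumes "infinite_gallery C EC t \<sigma> c" "a \<le> b"
  shows "gallery C EC t (map \<sigma> [a + 1..b]) (map c [a..b])"
proof -
  have "adjacent EC t (\<sigma> (a + 1 + int k)) (c (a + int k)) (c (a + 1 + int k))" for k
    using assms(1) unfolding infinite_gallery_def
    by (metis add.assoc add.commute add_diff_cancel_left')
  then show ?thesis
    using assms by (auto simp: gallery_def infinite_gallery_def nth_upto algebra_simps image_subset_iff)
qed

lemma ex_ray:
  assumes "a \<in> C" "\<And>n. \<tau> n \<in> I"
  shows "\<exists>d::nat \<Rightarrow> 'c. d 0 = a \<and> (\<forall>n. d n \<in> C \<and> adjacent EC t (\<tau> n) (d n) (d (Suc n)))"
proof -
  have "\<exists>d. \<forall>n. (d n \<in> C \<and> (n = 0 \<longrightarrow> d n = a)) \<and> adjacent EC t (\<tau> n) (d n) (d (Suc n))"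
  proof (rule dependent_nat_choice)
    show "\<exists>b. b \<in> C \<and> ((0::nat) = 0 \<longrightarrow> b = a)" using assms by blast
    fix b and n :: nat assume "b \<in> C \<and> (n = 0 \<longrightarrow> b = a)"
    then obtain b' where "b' \<in> C" "adjacent EC t (\<tau> n) b b'"
      using B1_exists assms(2) by blast
    then show "\<exists>b'. (b' \<in> C \<and> (Suc n = 0 \<longrightarrow> b' = a)) \<and> adjacent EC t (\<tau> n) b b'"
      by auto
  qed
  then show ?thesis by blast
qed

text \<open>The gallery occupies the positions from \<open>0\<close> to \<open>length is\<close>, where the letter of \<open>\<sigma>\<close> at \<open>s\<close> is
  the color of the step from \<open>s - 1\<close> to \<open>s\<close>. A ray is attached at each end.\<close>

lemma gallery_extends_to_infinite_gallery:
  assumes gal: "gallery C EC t is cs" and \<sigma>: "range \<sigma> \<subseteq> I"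
    and type: "\<And>k. k < length is \<Longrightarrow> \<sigma> (int k + 1) = is ! k"
  shows "\<exists>c. infinite_gallery C EC t \<sigma> c \<and> c 0 = hd cs \<and> c (int (length is)) = last cs"
proof -
  let ?L = "length is"
  have \<sigma>I: "\<sigma> s \<in> I" for s using \<sigma> by blast
  have len: "length cs = Suc ?L" and cs: "\<And>k. k \<le> ?L \<Longrightarrow> cs ! k \<in> C"
    and adj: "\<And>k. k < ?L \<Longrightarrow> adjacent EC t (is ! k) (cs ! k) (cs ! Suc k)"
    using gal by (auto simp: gallery_def in_lists_conv_set)
  obtain d where d0: "d 0 = cs ! 0" and dC: "\<And>n. d n \<in> C"
    and d: "\<And>n. adjacent EC t (\<sigma> (- int n)) (d n) (d (Suc n))"
    using ex_ray[of "cs ! 0" "\<lambda>n. \<sigma> (- int n)", OF _ \<sigma>I] cs[of 0] by auto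
  obtain e where e0: "e 0 = cs ! ?L" and eC: "\<And>n. e n \<in> C"
    and e: "\<And>n. adjacent EC t (\<sigma> (int ?L + int n + 1)) (e n) (e (Suc n))"
    using ex_ray[of "cs ! ?L" "\<lambda>n. \<sigma> (int ?L + int n + 1)", OF _ \<sigma>I] cs[of ?L] by auto
  define c where "c s = (if s < 0 then d (nat (- s)) else if s \<le> int ?L then cs ! nat s
    else e (nat (s - int ?L)))" for s :: int
  have c_left: "c s = d (nat (- s))" if "s \<le> 0" for s
    using that d0 by (simp add: c_def)
  have c_mid: "c (int k) = cs ! k" if "k \<le> ?L" for k
    using that by (simp add: c_def)
  have c_right: "c (int ?L + int n) = e n" for n
    using e0 by (simp add: c_def)
  have "adjacent EC t (\<sigma> s) (c (s - 1)) (c s)" for s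
  proof -
    consider n where "s = - int n" | k where "s = int k + 1" "k < ?L"
      | n where "s = int ?L + int n + 1"
    proof -
      have "s = - int (nat (- s))" if "s \<le> 0" using that by simp
      moreover have "s = int (nat (s - 1)) + 1" "nat (s - 1) < ?L" if "0 < s" "s \<le> int ?L"
        using that by simp_all
      moreover have "s = int ?L + int (nat (s - 1 - int ?L)) + 1" if "int ?L < s"
        using that by simp
      ultimately show thesis using that by (meson not_le)
    qed
    then show ?thesis
    proof cases
      case 1
      then show ?thesis using d[of "n"] adjacent_sym by (simp add: c_left nat_add_distrib)
    next
      case 2
      then show ?thesis
        using adj[of k] c_mid[of k] c_mid[of "Suc k"] type[of k] by (simp add: add.commute)
    next
      case 3
      then show ?thesis
        using e[of n] c_right[of n] c_right[of "Suc n"] by (simp add: ac_simps)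
    qed
  qed
  moreover have "c s \<in> C" for s
    using dC eC cs by (simp add: c_def)
  moreover have "c 0 = hd cs" "c (int ?L) = last cs"
    using c_mid[of 0] c_mid[of ?L] len by (auto simp: hd_conv_nth last_conv_nth simp flip: length_0_conv)
  ultimately show ?thesis by (auto simp: infinite_gallery_def)
qed

section \<open>The two transitivity properties\<close>

lemma infinitely_weyl_transitive_imp_weyl_transitive:
  assumes inf: "infinite (carrier (coxeter_group I m))"
    and trans: "infinitely_weyl_transitive G I m C EC t \<phi>"
  shows "weyl_transitive G C \<delta> \<phi>"
  unfolding weyl_transitive_def
proof (intro ballI impI)
  fix a b a' b' assume C: "a \<in> C" "b \<in> C" "a' \<in> C" "b' \<in> C" and eq: "\<delta> a b = \<delta> a' b'"
  obtain "is" where red: "reduced_word I m is" and w: "coxeter_prod I m is = \<delta> a b"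
    using ex_reduced_word distance C by blast
  obtain cs cs' where cs: "gallery C EC t is cs" "hd cs = a" "last cs = b"
    and cs': "gallery C EC t is cs'" "hd cs' = a'" "last cs' = b'"
    using B2[OF _ _ red] C w eq by metis
  obtain \<sigma> where \<sigma>: "reduced_string I m \<sigma>" "\<And>k. k < length is \<Longrightarrow> \<sigma> (int k + 1) = is ! k"
    using ex_reduced_string[OF inf red] by blast
  then have "range \<sigma> \<subseteq> I" by (simp add: reduced_string_def)
  note extend = gallery_extends_to_infinite_gallery[OF _ this \<sigma>(2)]
  obtain c where c: "infinite_gallery C EC t \<sigma> c" "c 0 = a" "c (int (length is)) = b"
    using extend[OF cs(1)] cs by blast
  obtain c' where c': "infinite_gallery C EC t \<sigma> c'" "c' 0 = a'" "c' (int (length is)) = b'"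
    using extend[OF cs'(1)] cs' by blast
  obtain g where "g \<in> carrier G" "\<forall>s. \<phi> g (c s) = c' s"
    using trans \<sigma>(1) c(1) c'(1) unfolding infinitely_weyl_transitive_def by blast
  then show "\<exists>g\<in>carrier G. \<phi> g a = a' \<and> \<phi> g b = b'"
    using c c' by metis
qed

text \<open>An element that matches the two ends maps the first gallery to one with the type and the ends
  of the second, and hence to the second itself.\<close>

lemma weyl_transitive_window:
  assumes trans: "weyl_transitive G C \<delta> \<phi>"
    and automorphisms: "\<And>g. g \<in> carrier G \<Longrightarrow> building_automorphism C EC t (\<phi> g)"
    and \<sigma>: "reduced_string I m \<sigma>"
    and c: "infinite_gallery C EC t \<sigma> c" and c': "infinite_gallery C EC t \<sigma> c'"
    and ab: "a \<le> b"
  shows "\<exists>g\<in>carrier G. \<forall>s\<in>{a..b}. \<phi> g (c s) = c' s"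
proof -
  let ?w = "map \<sigma> [a + 1..b]"
  have red: "reduced_word I m ?w" using \<sigma> by (rule reduced_string_imp_reduced_word)
  have gal: "gallery C EC t ?w (map c [a..b])" "gallery C EC t ?w (map c' [a..b])"
    using infinite_gallery_window c c' ab by auto
  have hd_last: "hd (map f [a..b]) = f a" "last (map f [a..b]) = f b" for f :: "int \<Rightarrow> 'c"
    using ab by (simp add: upto_rec1, simp add: upto_rec2)
  have "\<delta> (c a) (c b) = \<delta> (c' a) (c' b)"
    using gallery_distance[OF red gal(1)] gallery_distance[OF red gal(2)] by (simp add: hd_last)
  moreover have "c a \<in> C" "c b \<in> C" "c' a \<in> C" "c' b \<in> C"
    using c c' by (auto simp: infinite_gallery_def)
  ultimately obtain g where g: "g \<in> carrier G" "\<phi> g (c a) = c' a" "\<phi> g (c b) = c' b"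
    using trans unfolding weyl_transitive_def by metis
  have "map (\<phi> g) (map c [a..b]) = map c' [a..b]"
    using g hd_last[of c'] hd_last[of "\<phi> g \<circ> c"]
    by (intro reduced_gallery_unique[OF red gallery_automorphism[OF automorphisms[OF g(1)] gal(1)] gal(2)])
      simp_all
  then have "\<forall>s\<in>{a..b}. \<phi> g (c s) = c' s"
    by simp
  then show ?thesis using g(1) by blast
qed

end

text \<open>The transporter from \<open>x\<close> to \<open>y\<close> is the projection to the group of the fibre of
  \<open>(g, x) \<mapsto> (g x, x)\<close> over \<open>(y, x)\<close>, which is compact by properness. It is closed because points
  of a discrete space are closed.\<close>

lemma proper_action_transporter:
  assumes "proper_action T (discrete_topology C) \<phi>" "x \<in> C" "y \<in> C"
  shows compactin_transporter: "compactin T {g \<in> topspace T. \<phi> g x = y}"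
    and closedin_transporter: "closedin T {g \<in> topspace T. \<phi> g x = y}"
proof -
  let ?D = "discrete_topology C"
  let ?f = "\<lambda>(g, x). (\<phi> g x, x)"
  have "compactin (prod_topology T ?D) {p \<in> topspace (prod_topology T ?D). ?f p \<in> {(y, x)}}"
    using assms unfolding proper_action_def
    by (intro compactin_proper_map_preimage[where Y = "prod_topology ?D ?D"]) auto
  then have "compactin T (fst ` {p \<in> topspace (prod_topology T ?D). ?f p \<in> {(y, x)}})"
    by (rule image_compactin[OF _ continuous_map_fst])
  also have "fst ` {p \<in> topspace (prod_topology T ?D). ?f p \<in> {(y, x)}} =
      {g \<in> topspace T. \<phi> g x = y}"
    using assms by (force simp: image_iff)
  finally show "compactin T {g \<in> topspace T. \<phi> g x = y}" .
  have "continuous_map T (prod_topology T ?D) (\<lambda>g. (g, x))"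
    using assms by (simp add: continuous_map_pairedI)
  moreover have "continuous_map (prod_topology T ?D) ?D (\<lambda>(g, x). \<phi> g x)"
    using assms by (simp add: proper_action_def continuous_action_def)
  ultimately have "continuous_map T ?D ((\<lambda>(g, x). \<phi> g x) \<circ> (\<lambda>g. (g, x)))"
    by (rule continuous_map_compose)
  then have "continuous_map T ?D (\<lambda>g. \<phi> g x)"
    by (simp add: comp_def)
  then show "closedin T {g \<in> topspace T. \<phi> g x = y}"
    using closedin_continuous_map_preimage[of T ?D "\<lambda>g. \<phi> g x" "{y}"] assms(3) by simp
qed

text \<open>A nested intersection of nonempty closed subsets of the compact transporter from \<open>c 0\<close> to
  \<open>c' 0\<close>.\<close>

lemma proper_action_limit:
  fixes c c' :: "int \<Rightarrow> 'c"
  assumes proper: "proper_action T (discrete_topology C) \<phi>"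
    and c: "range c \<subseteq> C" "range c' \<subseteq> C"
    and approx: "\<And>n::nat. \<exists>g\<in>topspace T. \<forall>s\<in>{- int n..int n}. \<phi> g (c s) = c' s"
  shows "\<exists>g\<in>topspace T. \<forall>s. \<phi> g (c s) = c' s"
proof -
  define A where "A s = {g \<in> topspace T. \<phi> g (c s) = c' s}" for s
  define K where "K n = (\<Inter>s\<in>{- int n..int n}. A s)" for n
  have A: "compactin T (A s)" "closedin T (A s)" for s
    unfolding A_def using proper_action_transporter[OF proper] c by (simp_all add: image_subset_iff)
  have "compact_space (subtopology T (A 0))"
    using A compactin_subspace by blast
  moreover have "closedin (subtopology T (A 0)) (K n)" for n
  proof (rule closedin_subset_topspace)
    show "closedin T (K n)" unfolding K_def using A by (intro closedin_INT) auto
    show "K n \<subseteq> A 0" by (auto simp: K_def)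
  qed
  moreover have "K n \<noteq> {}" for n
    using approx[of n] by (auto simp: K_def A_def)
  moreover have "decseq K"
    unfolding K_def by (intro decseq_SucI INF_superset_mono) auto
  ultimately have "(\<Inter>n. K n) \<noteq> {}" by (rule compact_space_imp_nest)
  then obtain g where g: "\<And>n. g \<in> K n" by blast
  have "g \<in> A s" for s
    using g[of "nat \<bar>s\<bar>"] unfolding K_def by (rule INT_D) auto
  then show ?thesis by (auto simp: A_def)
qed

theorem theorem5p2:
  fixes I :: "'i set" and m :: "'i \<Rightarrow> 'i \<Rightarrow> enat"
    and C :: "'c set" and EC :: "'c set set" and t :: "'c set \<Rightarrow> 'i"
    and \<delta> :: "'c \<Rightarrow> 'c \<Rightarrow> 'i word set"
    and G :: "('g, 'x) monoid_scheme" and T :: "'g topology"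
    and \<phi> :: "'g \<Rightarrow> 'c \<Rightarrow> 'c"
  assumes "building I m C EC t \<delta>"
    and "infinite (carrier (coxeter_group I m))"
    and "hausdorff_topological_group G T"
    and "group_action G C \<phi>"
    and "\<And>g. g \<in> carrier G \<Longrightarrow> building_automorphism C EC t (\<phi> g)"
    and "proper_action T (discrete_topology C) \<phi>"
  shows "infinitely_weyl_transitive G I m C EC t \<phi> \<longleftrightarrow> weyl_transitive G C \<delta> \<phi>"
proof
  interpret building I m C EC t \<delta> by fact
  show "weyl_transitive G C \<delta> \<phi>" if "infinitely_weyl_transitive G I m C EC t \<phi>"
    by (rule infinitely_weyl_transitive_imp_weyl_transitive[OF assms(2) that])
  show "infinitely_weyl_transitive G I m C EC t \<phi>" if trans: "weyl_transitive G C \<delta> \<phi>"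
    unfolding infinitely_weyl_transitive_def
  proof (intro allI impI)
    fix \<sigma> c c'
    assume \<sigma>: "reduced_string I m \<sigma>"
      and c: "infinite_gallery C EC t \<sigma> c" and c': "infinite_gallery C EC t \<sigma> c'"
    have T: "topspace T = carrier G"
      using assms(3) by (rule hausdorff_topological_group.topspace)
    have "range c \<subseteq> C" "range c' \<subseteq> C"
      using c c' by (auto simp: infinite_gallery_def)
    moreover have "\<exists>g\<in>topspace T. \<forall>s\<in>{- int n..int n}. \<phi> g (c s) = c' s" for n
      unfolding T by (rule weyl_transitive_window[OF trans assms(5) \<sigma> c c']) simp_all
    ultimately show "\<exists>g\<in>carrier G. \<forall>s. \<phi> g (c s) = c' s"
      using proper_action_limit[OF assms(6)] unfolding T by blast
  qed
qed

end
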